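(* Let $k\ge3$ and let $G$ be a $k$-graph with vertex set $\{1,\dots,n\}$, vertex degrees $d_1,\dots,d_n$ (all positive) and Laplacian tensor $\mathcal L$. The largest H$^+$-eigenvalue of $\mathcal L$ is $\Delta=\max_i d_i$, and $$\Delta=\max\Big\{\mathcal Lx^k : x\in\mathbb R^n_+,\ \sum_{i=1}^n x_i^k=1\Big\}.$$
   Context: A $k$-graph $G=(V,E)$ consists of a vertex set $V=\{1,\dots,n\}$ and a set $E$ of distinct $k$-element subsets of $V$ (edges). Standing assumption: every vertex lies in at least one edge. The degree $d_i$ of vertex $i$ is the number of edges containing $i$. The adjacency tensor $\mathcal A=(a_{i_1\cdots i_k})$ is the $k$th order $n$-dimensional symmetric tensor with $a_{i_1\cdots i_k}=\frac1{(k-1)!}$ if $\{i_1,\dots,i_k\}\in E$ (in particular the indices are then distinct), and $0$ otherwise. The degree tensor $\mathcal D$ is the $k$th order $n$-dimensional diagonal tensor with $i$th diagonal entry $d_i$. The Laplacian tensor is $\mathcal L=\mathcal D-\mathcal A$. For a real $k$th order $n$-dimensional tensor $\mathcal T=(t_{i_1\cdots i_k})$ and a vector $x$, $\mathcal Tx^k=\sum_{i_1,\dots,i_k=1}^n t_{i_1\cdots i_k}x_{i_1}\cdots x_{i_k}$, $\mathcal Tx^{k-1}$ is the vector with $i$th component $\sum_{i_2,\dots,i_k=1}^n t_{ii_2\cdots i_k}x_{i_2}\cdots x_{i_k}$, and $x^{[k-1]}$ is the vector with components $x_i^{k-1}$. A real number $\lambda$ is an H$^+$-eigenvalue of $\mathcal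 T$ if there is a nonzero $x\in\mathbb R^n_+$ with $\mathcal Tx^{k-1}=\lambda x^{[k-1]}$, where $\mathbb R^n_+$ is the set of vectors in $\mathbb R^n$ with nonnegative components. *)

theory Defs
  imports "HOL-Analysis.Analysis"
begin

text \<open>
  The vertex set \<open>{1, ..., n}\<close> is the universe of a type \<open>'n\<close> of class \<^class>\<open>finite\<close>, where
  \<open>n = CARD('n)\<close>, and vectors have type \<open>real ^ 'n\<close>. A \<open>k\<close>-graph is given by its set of edges.
\<close>

definition k_graph :: "nat \<Rightarrow> 'n::finite set set \<Rightarrow> bool" where
  "k_graph k E \<longleftrightarrow> (\<forall>e\<in>E. card e = k)"

definition vdegree :: "'n::finite set set \<Rightarrow> 'n \<Rightarrow> nat" where
  "vdegree E v = card {e \<in> E. v \<in> e}"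

definition max_degree :: "'n::finite set set \<Rightarrow> nat" where
  "max_degree E = Max (range (vdegree E))"

text \<open>
  A tensor is a function on index lists \<open>[i\<^sub>1, ..., i\<^sub>k]\<close>. The order \<open>k\<close> is a separate
  argument: only the values at lists of length \<open>k\<close> matter.
\<close>

type_synonym 'n tensor = "'n list \<Rightarrow> real"

definition tensor_form :: "nat \<Rightarrow> 'n::finite tensor \<Rightarrow> real ^ 'n \<Rightarrow> real" where
  "tensor_form k T x =
     (\<Sum>js\<in>{js. length js = k}. T js * prod_list (map (\<lambda>j. x $ j) js))"

definition tensor_apply :: "nat \<Rightarrow> 'n::finite tensor \<Rightarrow> real ^ 'n \<Rightarrow> real ^ 'n" where
  "tensor_apply k T x =
     (\<chi> i. \<Sum>js\<in>{js. length js = k - 1}. T (i # js) * prod_list (map (\<lambda>j. x $ j) js))"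

definition vec_power :: "real ^ 'n::finite \<Rightarrow> nat \<Rightarrow> real ^ 'n" where
  "vec_power x m = (\<chi> i. (x $ i) ^ m)"

definition nonneg_vecs :: "(real ^ 'n::finite) set" where
  "nonneg_vecs = {x. \<forall>i. 0 \<le> x $ i}"

definition H_plus_eigenvalue :: "nat \<Rightarrow> 'n::finite tensor \<Rightarrow> real \<Rightarrow> bool" where
  "H_plus_eigenvalue k T l \<longleftrightarrow>
     (\<exists>x\<in>nonneg_vecs. x \<noteq> 0 \<and> tensor_apply k T x = l *\<^sub>R vec_power x (k - 1))"

text \<open>
  If \<open>set js \<in> E\<close> for a list \<open>js\<close> of length \<open>k\<close>, then the entries of \<open>js\<close> are distinct, because
  all edges have \<open>k\<close> elements.
\<close>

definition adjacency_tensor :: "nat \<Rightarrow> 'n::finite set set \<Rightarrow> 'n tensor" where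
  "adjacency_tensor k E js = (if length js = k \<and> set js \<in> E then 1 / fact (k - 1) else 0)"

definition degree_tensor :: "nat \<Rightarrow> 'n::finite set set \<Rightarrow> 'n tensor" where
  "degree_tensor k E js = (if js = replicate k (hd js) then real (vdegree E (hd js)) else 0)"

definition laplacian_tensor :: "nat \<Rightarrow> 'n::finite set set \<Rightarrow> 'n tensor" where
  "laplacian_tensor k E js = degree_tensor k E js - adjacency_tensor k E js"

definition is_maximum :: "real set \<Rightarrow> real \<Rightarrow> bool" where
  "is_maximum S m \<longleftrightarrow> m \<in> S \<and> (\<forall>y\<in>S. y \<le> m)"

end

theory Submission
  imports Defs
begin

text \<open>
  On nonnegative vectors the adjacency part of the Laplacian only lowers the value of the
  diagonal part, so every H\<open>\<^sup>+\<close>-eigenvalue and every value of the form on the unit sphere is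
  at most the maximum degree. Since an edge has at least three vertices, the adjacency part
  vanishes at each coordinate vector, and the coordinate vector of a vertex of maximum degree
  attains the bound.
\<close>

text \<open>Splitting each index list into head and tail groups the sum by its first index.
  Componentwise facts about \<open>tensor_apply\<close> thereby carry over to the form.\<close>

lemma tensor_form_eq_sum_tensor_apply:
  assumes "k \<ge> 1"
  shows "tensor_form k T x = (\<Sum>i\<in>UNIV. x $ i * tensor_apply k T x $ i)"
proof -
  obtain m where k: "k = Suc m"
    using assms by (cases k) auto
  have lists: "{js::'a list. length js = k} = (\<lambda>(i, js). i # js) ` (UNIV \<times> {js. length js = m})"
    by (auto simp: k length_Suc_conv image_iff)
  have "inj_on (\<lambda>(i, js). i # js) (UNIV \<times> {js::'a list. length js = m})"
    by (auto simp: inj_on_def)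
  then have "tensor_form k T x =
      (\<Sum>(i, js)\<in>UNIV \<times> {js. length js = m}. x $ i * (T (i # js) * prod_list (map (\<lambda>j. x $ j) js)))"
    unfolding tensor_form_def lists
    by (subst sum.reindex) (auto intro!: sum.cong)
  also have "\<dots> = (\<Sum>i\<in>UNIV. x $ i * tensor_apply k T x $ i)"
    by (simp add: sum.cartesian_product[symmetric] tensor_apply_def sum_distrib_left k)
  finally show ?thesis .
qed

lemma tensor_apply_degree:
  assumes "k \<ge> 1"
  shows "tensor_apply k (degree_tensor k E) x $ i = real (vdegree E i) * (x $ i) ^ (k - 1)"
proof -
  obtain m where k: "k = Suc m"
    using assms by (cases k) auto
  have fin: "finite {js::'a list. length js = m}"
    using finite_lists_length_eq[of "UNIV::'a set" m] by simp
  \<comment> \<open>With head \<open>i\<close> fixed, the list is diagonal only if its tail is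
    \<open>replicate m i\<close>, so a single summand survives.\<close>
  have "tensor_apply k (degree_tensor k E) x $ i =
      (\<Sum>js\<in>{js. length js = m}. if js = replicate m i
        then real (vdegree E i) * prod_list (map (\<lambda>j. x $ j) js) else 0)"
    by (auto simp: tensor_apply_def degree_tensor_def k intro!: sum.cong)
  also have "\<dots> = real (vdegree E i) * (x $ i) ^ m"
    using fin by (simp add: prod_list_replicate)
  finally show ?thesis
    by (simp add: k)
qed

lemma tensor_apply_laplacian:
  assumes "k \<ge> 1"
  shows "tensor_apply k (laplacian_tensor k E) x $ i =
    real (vdegree E i) * (x $ i) ^ (k - 1) - tensor_apply k (adjacency_tensor k E) x $ i"
proof -
  have "tensor_apply k (laplacian_tensor k E) x $ i =
      tensor_apply k (degree_tensor k E) x $ i - tensor_apply k (adjacency_tensor k E) x $ i"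
    by (simp add: tensor_apply_def laplacian_tensor_def left_diff_distrib sum_subtractf)
  then show ?thesis
    using assms by (simp add: tensor_apply_degree)
qed

lemma tensor_apply_adjacency_nonneg:
  assumes "x \<in> nonneg_vecs"
  shows "0 \<le> tensor_apply k (adjacency_tensor k E) x $ i"
proof -
  have "0 \<le> prod_list (map (\<lambda>j. x $ j) js)" for js
    using assms by (intro prod_list_nonneg) (auto simp: nonneg_vecs_def)
  then show ?thesis
    by (auto simp: tensor_apply_def adjacency_tensor_def intro!: sum_nonneg)
qed

lemma tensor_apply_laplacian_le:
  assumes "k \<ge> 1" "x \<in> nonneg_vecs"
  shows "tensor_apply k (laplacian_tensor k E) x $ i \<le> real (vdegree E i) * (x $ i) ^ (k - 1)"
  using assms by (simp add: tensor_apply_laplacian tensor_apply_adjacency_nonneg)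

text \<open>Every summand vanishes: a tail with an index other than \<open>v\<close> contributes a
  zero factor, and a tail inside \<open>{v}\<close> leaves too few distinct indices to form an
  edge.\<close>

lemma tensor_apply_adjacency_axis:
  assumes "k \<ge> 3" "k_graph k E"
  shows "tensor_apply k (adjacency_tensor k E) (axis v 1) $ i = 0"
proof -
  have "adjacency_tensor k E (i # js) * prod_list (map (\<lambda>j. axis v 1 $ j) js) = 0" for js
  proof (cases "set js \<subseteq> {v}")
    case True
    \<comment> \<open>At most two distinct indices occur. This is where \<open>k \<ge> 3\<close>
      matters: for \<open>k = 2\<close> the set \<open>{i, v}\<close> could be an edge.\<close>
    then have "card (set (i # js)) \<le> card {i, v}"
      by (intro card_mono) auto
    also have "\<dots> < k"
      using assms(1) by (simp add: card_insert_if)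
    finally have "set (i # js) \<notin> E"
      using assms(2) by (auto simp: k_graph_def)
    then show ?thesis
      by (simp add: adjacency_tensor_def)
  next
    case False
    then show ?thesis
      by (force simp: prod_list_zero_iff axis_def image_iff)
  qed
  then show ?thesis
    unfolding tensor_apply_def vec_lambda_beta by (intro sum.neutral ballI)
qed

lemma axis_power: "m > 0 \<Longrightarrow> (axis v (1::real) $ i) ^ m = axis v 1 $ i"
  by (simp add: axis_def)

lemma tensor_apply_laplacian_axis:
  assumes "k \<ge> 3" "k_graph k E"
  shows "tensor_apply k (laplacian_tensor k E) (axis v 1) =
    real (vdegree E v) *\<^sub>R vec_power (axis v 1) (k - 1)"
  using assms
  \<comment> \<open>The positive exponent \<open>k - 1\<close> disappears by
    \<open>axis_power\<close>. Component \<open>i\<close> carries \<open>vdegree E i\<close> instead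
    of \<open>vdegree E v\<close>, which is harmless because \<open>axis v 1\<close> is zero off
    \<open>v\<close>.\<close>
  by (auto simp: vec_eq_iff tensor_apply_laplacian tensor_apply_adjacency_axis vec_power_def
      axis_power) (auto simp: axis_def)

lemma vdegree_le_max_degree: "vdegree E v \<le> max_degree E"
  by (simp add: max_degree_def)

lemma max_degree_attained: "\<exists>v. vdegree E v = max_degree E"
proof -
  have "max_degree E \<in> range (vdegree E)"
    unfolding max_degree_def by (intro Max_in) auto
  then show ?thesis
    by auto
qed

lemma H_plus_eigenvalue_laplacian_le_max_degree:
  assumes "k \<ge> 1" "H_plus_eigenvalue k (laplacian_tensor k E) l"
  shows "l \<le> real (max_degree E)"
proof -
  obtain x where x: "x \<in> nonneg_vecs" "x \<noteq> 0"
    and eig: "tensor_apply k (laplacian_tensor k E) x = l *\<^sub>R vec_power x (k - 1)"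
    using assms(2) by (auto simp: H_plus_eigenvalue_def)
  \<comment> \<open>At a positive coordinate the factor \<open>(x $ i) ^ (k - 1)\<close> can be
    cancelled from the eigenvalue equation.\<close>
  obtain i where i: "x $ i > 0"
    using x by (auto simp: vec_eq_iff nonneg_vecs_def less_le)
  have "l * (x $ i) ^ (k - 1) \<le> real (vdegree E i) * (x $ i) ^ (k - 1)"
    using tensor_apply_laplacian_le[OF assms(1) x(1), of E i] by (simp add: eig vec_power_def)
  then have "l \<le> real (vdegree E i)"
    using i by simp
  also have "\<dots> \<le> real (max_degree E)"
    by (simp add: vdegree_le_max_degree)
  finally show ?thesis .
qed

text \<open>The componentwise bound is multiplied by \<open>x $ i \<ge> 0\<close> and summed over
  \<open>i\<close>. On the unit sphere of the \<open>k\<close>-norm the last factor is 1.\<close>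

lemma tensor_form_laplacian_le_max_degree:
  assumes "k \<ge> 1" "x \<in> nonneg_vecs"
  shows "tensor_form k (laplacian_tensor k E) x \<le> real (max_degree E) * (\<Sum>i\<in>UNIV. (x $ i) ^ k)"
proof -
  have nonneg: "0 \<le> x $ i" for i
    using assms(2) by (simp add: nonneg_vecs_def)
  have "x $ i * tensor_apply k (laplacian_tensor k E) x $ i \<le> real (max_degree E) * (x $ i) ^ k" for i
  proof -
    have "x $ i * tensor_apply k (laplacian_tensor k E) x $ i
        \<le> x $ i * (real (vdegree E i) * (x $ i) ^ (k - 1))"
      using assms nonneg by (intro mult_left_mono tensor_apply_laplacian_le)
    also have "\<dots> = real (vdegree E i) * (x $ i) ^ k"
      using assms(1) by (cases k) auto
    also have "\<dots> \<le> real (max_degree E) * (x $ i) ^ k"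
      using nonneg by (intro mult_right_mono) (auto simp: vdegree_le_max_degree)
    finally show ?thesis .
  qed
  then show ?thesis
    using assms(1) by (simp add: tensor_form_eq_sum_tensor_apply sum_distrib_left sum_mono)
qed

lemma axis_in_nonneg_vecs: "axis v 1 \<in> nonneg_vecs"
  by (simp add: nonneg_vecs_def axis_def)

theorem theorem10:
  fixes E :: "'n::finite set set" and k :: nat
  assumes "k \<ge> 3"
    and "k_graph k E"
    and "\<forall>v. vdegree E v > 0"
  shows "is_maximum {l. H_plus_eigenvalue k (laplacian_tensor k E) l} (real (max_degree E))
    \<and> is_maximum {tensor_form k (laplacian_tensor k E) x | x.
          x \<in> nonneg_vecs \<and> (\<Sum>i\<in>UNIV. (x $ i) ^ k) = 1} (real (max_degree E))"
proof -
  \<comment> \<open>The vector \<open>axis v 1\<close> serves as witness for both maxima: as an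
    eigenvector and as a maximizer of the form.\<close>
  obtain v where v: "vdegree E v = max_degree E"
    using max_degree_attained by blast
  have k: "k \<ge> 1"
    using assms(1) by simp
  have axis: "tensor_apply k (laplacian_tensor k E) (axis v 1) =
      real (max_degree E) *\<^sub>R vec_power (axis v 1) (k - 1)"
    using tensor_apply_laplacian_axis[OF assms(1,2), of v] by (simp add: v)
  have "axis v (1::real) \<noteq> 0"
    by (simp add: axis_eq_0_iff)
  then have eigenvalue: "H_plus_eigenvalue k (laplacian_tensor k E) (real (max_degree E))"
    unfolding H_plus_eigenvalue_def using axis axis_in_nonneg_vecs by blast
  \<comment> \<open>The eigenvalue equation gives the value of the form: only the component at
    \<open>v\<close> contributes.\<close>
  have "tensor_form k (laplacian_tensor k E) (axis v 1) =
      (\<Sum>i\<in>UNIV. if i = v then real (max_degree E) else 0)"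
    unfolding tensor_form_eq_sum_tensor_apply[OF k] axis
    by (intro sum.cong) (auto simp: vec_power_def axis_def)
  then have form: "real (max_degree E) = tensor_form k (laplacian_tensor k E) (axis v 1)"
    by simp
  have unit: "(\<Sum>i\<in>UNIV. (axis v (1::real) $ i) ^ k) = 1"
    using k by (simp add: axis_power) (simp add: axis_def)
  have "tensor_form k (laplacian_tensor k E) x \<le> real (max_degree E)"
    if "x \<in> nonneg_vecs" "(\<Sum>i\<in>UNIV. (x $ i) ^ k) = 1" for x
    using tensor_form_laplacian_le_max_degree[OF k that(1), of E] that(2) by simp
  then show ?thesis
    using eigenvalue form unit axis_in_nonneg_vecs H_plus_eigenvalue_laplacian_le_max_degree[OF k]
    unfolding is_maximum_def by blast
qed

end
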